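(* Let $q \ge 2$ be a fixed integer and let $\theta \le 1/2$ be such that $$\frac{1}{2}\log(1-2\theta) + (1-\theta)\log\left(\frac{1-\theta}{1-2\theta}\right) + \theta\log 2 - (1-2\theta)\log q > 0.$$ Then for all $n$ large enough, whenever a $k$-uniform state in $(\mathbb{C}^q)^{\otimes n}$ exists, we have $k \le \theta n$.
   Context: $\log$ denotes the natural logarithm. A pure state $|\psi\rangle \in (\mathbb{C}^q)^{\otimes n}$ is called $k$-uniform if, with $\rho = |\psi\rangle\langle\psi|$, for every subset $S \subseteq \{1,\dots,n\}$ with $|S| = k$ the reduced state of $\rho$ on the parties in $S$ equals $I/q^k$, where $I$ is the identity on $(\mathbb{C}^q)^{\otimes k}$. *)

theory Defs
  imports "HOL-Analysis.Analysis" "HOL-Library.FuncSet"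
begin

text \<open>Computational basis states of the parties in I, each party being a qudit
  with levels 0..q-1: extensional functions I -> {0..<q}.\<close>
definition configs :: "nat set \<Rightarrow> nat \<Rightarrow> (nat \<Rightarrow> nat) set" where
  "configs I q = PiE I (\<lambda>_. {..<q})"

definition glue :: "nat set \<Rightarrow> (nat \<Rightarrow> nat) \<Rightarrow> (nat \<Rightarrow> nat) \<Rightarrow> (nat \<Rightarrow> nat)" where
  "glue S x z = (\<lambda>i. if i \<in> S then x i else z i)"

text \<open>A pure state of n qudits of dimension q: the coefficient vector psi of
  |psi> in the computational basis of (C^q)^{\<otimes> n}, normalised.\<close>
definition pure_state :: "nat \<Rightarrow> nat \<Rightarrow> ((nat \<Rightarrow> nat) \<Rightarrow> complex) \<Rightarrow> bool" where
  "pure_state n q psi \<longleftrightarrow> (\<Sum>x\<in>configs {..<n} q. (cmod (psi x))\<^sup>2) = 1"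

text \<open>Matrix entry <x| Tr_{S^c} |psi><psi| |y> of the reduced state on parties S.\<close>
definition reduced_state ::
  "nat \<Rightarrow> nat \<Rightarrow> nat set \<Rightarrow> ((nat \<Rightarrow> nat) \<Rightarrow> complex) \<Rightarrow> (nat \<Rightarrow> nat) \<Rightarrow> (nat \<Rightarrow> nat) \<Rightarrow> complex" where
  "reduced_state n q S psi x y =
     (\<Sum>z\<in>configs ({..<n} - S) q. psi (glue S x z) * cnj (psi (glue S y z)))"

definition k_uniform :: "nat \<Rightarrow> nat \<Rightarrow> nat \<Rightarrow> ((nat \<Rightarrow> nat) \<Rightarrow> complex) \<Rightarrow> bool" where
  "k_uniform n q k psi \<longleftrightarrow> pure_state n q psi \<and> k \<le> n \<and>
     (\<forall>S. S \<subseteq> {..<n} \<and> card S = k \<longrightarrow>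
        (\<forall>x\<in>configs S q. \<forall>y\<in>configs S q.
           reduced_state n q S psi x y = (if x = y then 1 / (of_nat q ^ k) else 0)))"

end

theory Submission
  imports Defs
begin

text \<open>For a set of parties T let B(T) = q^|T| tr (rho_T^2). Splitting the operators on each site
  orthogonally into multiples of the identity and traceless operators writes B(T) as the sum over
  S \<subseteq> T of weights A(S) \<ge> 0. For a k-uniform state B(T) = 1 if |T| = k, so that A(S) = 0 whenever
  0 < |S| \<le> k. Hence, for every R,
  (k + 1) (B(R) - 1) \<le> sum over S \<subseteq> R of |S| A(S) = sum over i \<in> R of (B(R) - B(R - i)).
  Since complementary parties have equal purity, B(R) = q^(2|R| - n) B(R^c); as B is monotone,
  this yields B(R - i) \<ge> B(R) / q^2 and B(R) \<ge> q^(2|R| - n). With |R| = n/2 + O(1) the result is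
  a Plotkin bound k \<le> (1 - 1/q^2) n/2 + o(n), and the hypothesis on theta forces
  theta > (1 - 1/q^2)/2.\<close>

section \<open>The condition on theta\<close>

text \<open>With \<open>d = 1 - 2*\<theta>\<close> the hypothesis becomes an upper bound on
  \<open>d * (2 * ln 2 + 2 * ln q)\<close>, which contradicts \<open>d \<ge> 1/q\<^sup>2\<close>.
  Both cases below end in 4/3 < 5/4, using \<open>ln 2 \<ge> 2/3\<close>.\<close>

lemma hypothesis_imp_plotkin_ratio:
  fixes q :: nat and \<theta> :: real
  assumes "q \<ge> 2" and "\<theta> \<le> 1/2"
    and pos: "(1/2) * ln (1 - 2*\<theta>) + (1 - \<theta>) * ln ((1 - \<theta>) / (1 - 2*\<theta>))
          + \<theta> * ln 2 - (1 - 2*\<theta>) * ln (real q) > 0"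
  shows "(1 - 1 / (real q)\<^sup>2) / 2 < \<theta>"
proof (rule ccontr)
  assume neg: "\<not> ?thesis"
  define d where "d = 1 - 2*\<theta>"
  have q: "real q \<ge> 2" using \<open>q \<ge> 2\<close> by simp
  have dq: "d \<ge> 1 / (real q)\<^sup>2" using neg by (simp add: d_def)
  have "1 / (real q)\<^sup>2 > 0" using q by simp
  \<comment> \<open>The negated conclusion rules out theta = 1/2, so neither \<open>ln 0\<close> nor
    a division by 0 occurs from here on.\<close>
  then have d0: "d > 0" using dq by linarith
  have th: "\<theta> = (1 - d) / 2" by (simp add: d_def)
  have "ln ((1 - \<theta>) / (1 - 2*\<theta>)) = ln (((1 + d) / 2) / d)" 
    by (simp add: th field_simps)
  also have "\<dots> = ln (1 + d) - ln 2 - ln d"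
    using d0 by (simp add: ln_div ln_mult)
  finally have l1: "ln ((1 - \<theta>) / (1 - 2*\<theta>)) = ln (1 + d) - ln 2 - ln d" .
  have "(1/2) * ln d + (1 + d) / 2 * (ln (1 + d) - ln 2 - ln d)
          + (1 - d) / 2 * ln 2 - d * ln (real q) > 0"
    using pos unfolding l1 by (simp add: th field_simps)
  then have main: "2 * (d * ln 2) + d * (2 * ln (real q)) < (1 + d) * ln (1 + d) + d * (- ln d)"
    by (simp add: field_simps)
  have l2: "ln (2::real) \<ge> 2/3" by (rule ln2_ge_two_thirds)
  have lp: "ln (1 + d) \<le> d" using d0 by (simp add: ln_add_one_self_le_self)
  show False
  proof (cases "d \<le> 1/4")
    case True
    \<comment> \<open>For small d the term \<open>- ln d\<close> is absorbed by
      \<open>2 * ln q\<close>; what remains of \<open>main\<close>, divided by d, is 2 ln 2 <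
      5/4.\<close>
    have "ln (1 / (real q)\<^sup>2) \<le> ln d" 
    proof (rule ln_mono)
      show "0 < 1 / (real q)\<^sup>2" using q by simp
    qed (use dq d0 in auto)
    then have "- ln d \<le> 2 * ln (real q)" using q by (simp add: ln_div ln_realpow)
    then have "d * (- ln d) \<le> d * (2 * ln (real q))" using d0 by (intro mult_left_mono) auto
    moreover have "(1 + d) * ln (1 + d) \<le> (5/4) * d"
      using True d0 lp by (intro mult_mono) auto
    moreover have "d * ln 2 \<ge> d * (2/3)" using l2 d0 by (intro mult_left_mono) auto
    ultimately show False using main d0 by linarith
  next
    case False
    \<comment> \<open>For large d the quotient (1 + d)/d is at most 5 = 4 (1 + 1/4), and
      \<open>ln q \<ge> ln 2\<close> suffices.\<close>
    have "ln (1 + d) - ln d = ln ((1 + d) / d)" using d0 by (simp add: ln_div)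
    also have "\<dots> \<le> ln 5" using False d0 by (simp add: field_simps)
    also have "ln (5::real) = ln (2\<^sup>2 * (1 + 1/4))" by simp
    also have "\<dots> = 2 * ln 2 + ln (1 + 1/4)" 
      using ln_realpow[of 2 2] by (subst ln_mult_pos) simp_all
    also have "\<dots> \<le> 2 * ln 2 + 1/4"
      using ln_add_one_self_le_self[of "1/4::real"] by simp
    finally have "ln (1 + d) - ln d \<le> 2 * ln 2 + 1/4" .
    from mult_left_mono[OF this, of d]
    have "d * (ln (1 + d) - ln d) \<le> 2 * (d * ln 2) + d / 4"
      using d0 by (simp add: algebra_simps)
    moreover have "ln 2 \<le> ln (real q)" using q by simp
    then have "d * ln 2 \<le> d * ln (real q)" using d0 by (intro mult_left_mono) auto
    moreover have "d * ln 2 \<ge> d * (2/3)" using l2 d0 by (intro mult_left_mono) auto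
    moreover have "2 * (d * ln 2) + 2 * (d * ln (real q)) < ln (1 + d) + d * (ln (1 + d) - ln d)"
      using main by (simp add: algebra_simps)
    ultimately show False using lp d0 by linarith
  qed
qed

section \<open>Quadratic forms on operators and their traceless components\<close>

text \<open>If f is the matrix of an operator on the sites below n, this is q^n times its squared
  Hilbert-Schmidt norm after projecting it, at each site, to the traceless part (sites in D), to the
  multiples of the identity (sites outside F and D), or not at all (sites in F but not in D).\<close>
fun site_form :: "nat \<Rightarrow> nat set \<Rightarrow> nat set \<Rightarrow> nat
    \<Rightarrow> ((nat \<Rightarrow> nat) \<Rightarrow> (nat \<Rightarrow> nat) \<Rightarrow> complex) \<Rightarrow> real" where
  "site_form q F D 0 f = (cmod (f (\<lambda>_. undefined) (\<lambda>_. undefined)))\<^sup>2"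
| "site_form q F D (Suc n) f =
    (let full = real q * (\<Sum>a<q. \<Sum>b<q. site_form q F D n (\<lambda>x y. f (x(n:=a)) (y(n:=b))));
         tr = site_form q F D n (\<lambda>x y. \<Sum>a<q. f (x(n:=a)) (y(n:=a)))
     in if n \<in> D then full - tr else if n \<in> F then full else tr)"

lemma site_form_cong:
  assumes "\<And>i. i < n \<Longrightarrow> i \<in> F \<longleftrightarrow> i \<in> F'" "\<And>i. i < n \<Longrightarrow> i \<in> D \<longleftrightarrow> i \<in> D'"
  shows "site_form q F D n f = site_form q F' D' n f"
  using assms
proof (induction n arbitrary: f)
  case (Suc n)
  have "site_form q F D n g = site_form q F' D' n g" for g
    by (rule Suc.IH) (use Suc.prems less_SucI in blast)+
  then show ?case using Suc.prems by (simp add: Let_def)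
qed simp

text \<open>Variance through pairwise differences: on expanding
  \<open>(cmod (u a - u b))\<^sup>2\<close> the cross terms add up to the squared modulus of the
  total.\<close>

lemma cmod_sum_variance:
  fixes u :: "nat \<Rightarrow> complex"
  shows "real m * (\<Sum>a<m. (cmod (u a))\<^sup>2) - (cmod (\<Sum>a<m. u a))\<^sup>2
    = (1/2) * (\<Sum>a<m. \<Sum>b<m. (cmod (u a - u b))\<^sup>2)"
proof -
  have *: "(cmod (u a - u b))\<^sup>2 = (cmod (u a))\<^sup>2 + (cmod (u b))\<^sup>2 - 2 * Re (u a * cnj (u b))" for a b
    unfolding cmod_power2 by (simp add: power2_eq_square algebra_simps)
  have "complex_of_real ((cmod (\<Sum>a<m. u a))\<^sup>2) = (\<Sum>a<m. \<Sum>b<m. u a * cnj (u b))"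
    unfolding complex_norm_square by (simp add: sum_product)
  then have "(cmod (\<Sum>a<m. u a))\<^sup>2 = Re (\<Sum>a<m. \<Sum>b<m. u a * cnj (u b))"
    by (metis Re_complex_of_real)
  then have "(cmod (\<Sum>a<m. u a))\<^sup>2 = (\<Sum>a<m. \<Sum>b<m. Re (u a * cnj (u b)))"
    by (simp only: Re_sum)
  moreover have "(\<Sum>a<m. \<Sum>b<m. (cmod (u a - u b))\<^sup>2)
      = 2 * (real m * (\<Sum>a<m. (cmod (u a))\<^sup>2)) - 2 * (\<Sum>a<m. \<Sum>b<m. Re (u a * cnj (u b)))"
    unfolding * sum.distrib sum_subtractf sum_distrib_left[symmetric] sum_constant card_lessThan
    by simp
  ultimately show ?thesis by simp
qed

lemma sum_swap_pairs:
  "(\<Sum>a\<in>A. \<Sum>b\<in>B. \<Sum>c\<in>C. \<Sum>d\<in>D. f a b c d) = (\<Sum>c\<in>C. \<Sum>d\<in>D. \<Sum>a\<in>A. \<Sum>b\<in>B. f a b c d)"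
proof -
  have "(\<Sum>a\<in>A. \<Sum>b\<in>B. \<Sum>c\<in>C. \<Sum>d\<in>D. f a b c d) = (\<Sum>a\<in>A. \<Sum>c\<in>C. \<Sum>b\<in>B. \<Sum>d\<in>D. f a b c d)"
    by (intro sum.cong refl sum.swap)
  also have "\<dots> = (\<Sum>c\<in>C. \<Sum>a\<in>A. \<Sum>d\<in>D. \<Sum>b\<in>B. f a b c d)"
    by (subst sum.swap) (intro sum.cong refl sum.swap)
  also have "\<dots> = (\<Sum>c\<in>C. \<Sum>d\<in>D. \<Sum>a\<in>A. \<Sum>b\<in>B. f a b c d)"
    by (intro sum.cong refl sum.swap)
  finally show ?thesis .
qed

text \<open>The variance identity passes through the recursion: \<open>full\<close> and
  \<open>tr\<close> apply the form on n sites to linear images of the argument, so each inherits the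
  identity, and hence so does their difference.\<close>

lemma site_form_variance:
  "real m * (\<Sum>a<m. site_form q F D n (g a)) - site_form q F D n (\<lambda>x y. \<Sum>a<m. g a x y)
    = (1/2) * (\<Sum>a<m. \<Sum>b<m. site_form q F D n (\<lambda>x y. g a x y - g b x y))"
proof (induction n arbitrary: g)
  case 0
  show ?case by (simp add: cmod_sum_variance)
next
  case (Suc n)
  let ?Q = "site_form q F D n"
  define V where "V h = real m * (\<Sum>a<m. ?Q (h a)) - ?Q (\<lambda>x y. \<Sum>a<m. h a x y)"
    for h :: "nat \<Rightarrow> (nat \<Rightarrow> nat) \<Rightarrow> (nat \<Rightarrow> nat) \<Rightarrow> complex"
  define W where "W h = (1/2) * (\<Sum>a<m. \<Sum>b<m. ?Q (\<lambda>x y. h a x y - h b x y))"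
    for h :: "nat \<Rightarrow> (nat \<Rightarrow> nat) \<Rightarrow> (nat \<Rightarrow> nat) \<Rightarrow> complex"
  have VW: "V h = W h" for h unfolding V_def W_def by (rule Suc.IH)
  define full where "full f = real q * (\<Sum>a<q. \<Sum>b<q. ?Q (\<lambda>x y. f (x(n:=a)) (y(n:=b))))" for f
  define tr where "tr f = ?Q (\<lambda>x y. \<Sum>a<q. f (x(n:=a)) (y(n:=a)))" for f
  have ful: "real m * (\<Sum>a<m. full (g a)) - full (\<lambda>x y. \<Sum>a<m. g a x y)
    = (1/2) * (\<Sum>a<m. \<Sum>b<m. full (\<lambda>x y. g a x y - g b x y))"
  proof -
    have "real m * (\<Sum>a<m. full (g a)) - full (\<lambda>x y. \<Sum>a<m. g a x y)
      = real q * (\<Sum>c<q. \<Sum>d<q. V (\<lambda>a x y. g a (x(n:=c)) (y(n:=d))))"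
    proof -
      have "(\<Sum>a<m. full (g a)) =
          real q * (\<Sum>c<q. \<Sum>d<q. \<Sum>a<m. ?Q (\<lambda>x y. g a (x(n:=c)) (y(n:=d))))"
        unfolding full_def sum_distrib_left[symmetric]
        by (subst sum.swap, subst (2) sum.swap) simp
      then show ?thesis
        by (simp add: V_def full_def sum_subtractf sum_distrib_left algebra_simps)
    qed
    also have "\<dots> = real q * (\<Sum>c<q. \<Sum>d<q. W (\<lambda>a x y. g a (x(n:=c)) (y(n:=d))))"
      by (simp only: VW)
    also have "\<dots> = (1/2) * (\<Sum>a<m. \<Sum>b<m. full (\<lambda>x y. g a x y - g b x y))"
    proof -
      have "(\<Sum>c<q. \<Sum>d<q. \<Sum>a<m. \<Sum>b<m. ?Q (\<lambda>x y. g a (x(n:=c)) (y(n:=d)) - g b (x(n:=c)) (y(n:=d))))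
         = (\<Sum>a<m. \<Sum>b<m. \<Sum>c<q. \<Sum>d<q. ?Q (\<lambda>x y. g a (x(n:=c)) (y(n:=d)) - g b (x(n:=c)) (y(n:=d))))"
        by (rule sum_swap_pairs)
      then show ?thesis
        by (simp add: W_def full_def sum_distrib_left[symmetric] sum_divide_distrib[symmetric])
    qed
    finally show ?thesis .
  qed
  have trl: "real m * (\<Sum>a<m. tr (g a)) - tr (\<lambda>x y. \<Sum>a<m. g a x y)
    = (1/2) * (\<Sum>a<m. \<Sum>b<m. tr (\<lambda>x y. g a x y - g b x y))"
  proof -
    have sw: "(\<lambda>x y. \<Sum>c<q. \<Sum>a<m. g a (x(n:=c)) (y(n:=c))) = (\<lambda>x y. \<Sum>a<m. \<Sum>c<q. g a (x(n:=c)) (y(n:=c)))"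
      by (intro ext sum.swap)
    show ?thesis
      using VW[of "\<lambda>a x y. \<Sum>c<q. g a (x(n:=c)) (y(n:=c))"]
      unfolding V_def W_def tr_def sw sum_subtractf[symmetric] .
  qed
  have step: "site_form q F D (Suc n) f
      = (if n \<in> D then full f - tr f else if n \<in> F then full f else tr f)" for f
    by (simp add: Let_def full_def tr_def)
  show ?case
    unfolding step using ful trl
    by (auto simp: sum_subtractf algebra_simps)
qed

text \<open>Only \<open>full - tr\<close> needs an argument. The variance identity bounds
  \<open>tr\<close> by q times the sum over the diagonal blocks a = b, and these are among the
  blocks summed in \<open>full\<close>.\<close>

lemma site_form_nonneg: "site_form q F D n f \<ge> 0"
proof (induction n arbitrary: f)
  case (Suc n)
  let ?Q = "site_form q F D n"
  have "real q * (\<Sum>a<q. ?Q (\<lambda>x y. f (x(n:=a)) (y(n:=a))))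
      - ?Q (\<lambda>x y. \<Sum>a<q. f (x(n:=a)) (y(n:=a))) \<ge> 0"
    unfolding site_form_variance[where g = "\<lambda>a x y. f (x(n:=a)) (y(n:=a))"]
    by (intro mult_nonneg_nonneg sum_nonneg Suc.IH) simp
  moreover have "(\<Sum>a<q. ?Q (\<lambda>x y. f (x(n:=a)) (y(n:=a))))
      \<le> (\<Sum>a<q. \<Sum>b<q. ?Q (\<lambda>x y. f (x(n:=a)) (y(n:=b))))"
    by (intro sum_mono member_le_sum) (auto simp: Suc.IH)
  then have "real q * (\<Sum>a<q. ?Q (\<lambda>x y. f (x(n:=a)) (y(n:=a))))
      \<le> real q * (\<Sum>a<q. \<Sum>b<q. ?Q (\<lambda>x y. f (x(n:=a)) (y(n:=b))))"
    by (intro mult_left_mono) auto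
  ultimately show ?case by (auto simp: Let_def Suc.IH intro!: mult_nonneg_nonneg sum_nonneg)
qed simp

text \<open>Pythagoras, site by site: for n in R, the sets S containing n contribute
  \<open>full - tr\<close> and the others \<open>tr\<close>, which add up to
  \<open>full\<close>.\<close>

lemma site_form_eq_sum_traceless:
  "site_form q R {} n f = (\<Sum>S\<in>Pow (R \<inter> {..<n}). site_form q {} S n f)"
proof (induction n arbitrary: f)
  case (Suc n)
  let ?P = "Pow (R \<inter> {..<n})"
  have nP: "n \<notin> S" if "S \<in> ?P" for S using that by auto
  have tr: "(\<Sum>S\<in>?P. site_form q {} S (Suc n) f)
      = site_form q R {} n (\<lambda>x y. \<Sum>a<q. f (x(n:=a)) (y(n:=a)))"
    unfolding Suc.IH by (intro sum.cong) (auto simp: Let_def)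
  show ?case
  proof (cases "n \<in> R")
    case False
    then have "R \<inter> {..<Suc n} = R \<inter> {..<n}" by (auto simp: less_Suc_eq)
    then show ?thesis using False tr by (simp add: Let_def)
  next
    case True
    then have "R \<inter> {..<Suc n} = insert n (R \<inter> {..<n})" by (auto simp: less_Suc_eq)
    then have "(\<Sum>S\<in>Pow (R \<inter> {..<Suc n}). site_form q {} S (Suc n) f)
      = (\<Sum>S\<in>?P. site_form q {} S (Suc n) f) + (\<Sum>S\<in>insert n ` ?P. site_form q {} S (Suc n) f)"
      by (simp only: Pow_insert) (subst sum.union_disjoint; auto)
    also have "(\<Sum>S\<in>insert n ` ?P. site_form q {} S (Suc n) f)
      = (\<Sum>S\<in>?P. site_form q {} (insert n S) (Suc n) f)"
      by (subst sum.reindex) (auto simp: inj_on_def dest!: nP)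
    also have "\<dots> = (\<Sum>S\<in>?P. real q * (\<Sum>a<q. \<Sum>b<q. site_form q {} S n (\<lambda>x y. f (x(n:=a)) (y(n:=b))))
         - site_form q {} S n (\<lambda>x y. \<Sum>a<q. f (x(n:=a)) (y(n:=a))))"
    proof (rule sum.cong[OF refl])
      fix S assume "S \<in> ?P"
      \<comment> \<open>The two sets differ only at site n, which the recursion has already split
        off.\<close>
      have "site_form q {} (insert n S) n g = site_form q {} S n g" for g
        by (rule site_form_cong) auto
      then show "site_form q {} (insert n S) (Suc n) f
         = real q * (\<Sum>a<q. \<Sum>b<q. site_form q {} S n (\<lambda>x y. f (x(n:=a)) (y(n:=b))))
         - site_form q {} S n (\<lambda>x y. \<Sum>a<q. f (x(n:=a)) (y(n:=a)))"
        by (simp add: Let_def)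
    qed
    also have "\<dots> = real q * (\<Sum>a<q. \<Sum>b<q. site_form q R {} n (\<lambda>x y. f (x(n:=a)) (y(n:=b))))
         - site_form q R {} n (\<lambda>x y. \<Sum>a<q. f (x(n:=a)) (y(n:=a)))"
      unfolding Suc.IH sum_subtractf sum_distrib_left[symmetric]
      by (subst sum.swap, subst (2) sum.swap) simp
    finally show ?thesis using True tr by (simp add: Let_def)
  qed
qed simp

section \<open>Purities of reduced states and support weights\<close>

lemma finite_configs: "finite I \<Longrightarrow> finite (configs I q)"
  by (simp add: configs_def finite_PiE)

lemma sum_configs_insert:
  assumes "n \<notin> I"
  shows "(\<Sum>x\<in>configs (insert n I) q. g x) = (\<Sum>a<q. \<Sum>x\<in>configs I q. g (x(n:=a)))"
proof -
  have "(\<Sum>x\<in>configs (insert n I) q. g x) = (\<Sum>(a, x)\<in>{..<q} \<times> configs I q. g (x(n:=a)))"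
    unfolding configs_def PiE_insert_eq
    by (subst sum.reindex[OF inj_combinator[OF assms]]) (simp add: split_def)
  then show ?thesis by (simp add: sum.cartesian_product)
qed

text \<open>Unrolling the recursion, a site in R yields a factor q and free row and column indices,
  a site outside R a partial trace.\<close>

lemma site_form_eq_purity:
  "site_form q R {} n f = real q ^ card (R \<inter> {..<n}) *
    (\<Sum>x\<in>configs (R \<inter> {..<n}) q. \<Sum>y\<in>configs (R \<inter> {..<n}) q.
      (cmod (\<Sum>z\<in>configs ({..<n} - R) q. f (glue R x z) (glue R y z)))\<^sup>2)"
proof (induction n arbitrary: f)
  case 0
  \<comment> \<open>The empty set of parties has the single configuration
    \<open>\<lambda>_. undefined\<close>, where the recursion stops.\<close>
  then show ?case by (simp add: configs_def glue_def)
next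
  case (Suc n)
  show ?case
  proof (cases "n \<in> R")
    case True
    have 1: "R \<inter> {..<Suc n} = insert n (R \<inter> {..<n})" "{..<Suc n} - R = {..<n} - R"
      using True by (auto simp: less_Suc_eq)
    have 2: "glue R (x(n:=a)) z = (glue R x z)(n:=a)" for x z a
      using True by (auto simp: glue_def)
    show ?thesis
      unfolding 1 using True
      by (simp add: Let_def sum_configs_insert Suc.IH 2 sum_distrib_left[symmetric])
        (subst (2) sum.swap, simp)
  next
    case False
    have 1: "R \<inter> {..<Suc n} = R \<inter> {..<n}" "{..<Suc n} - R = insert n ({..<n} - R)"
      using False by (auto simp: less_Suc_eq)
    have 2: "glue R x (z(n:=a)) = (glue R x z)(n:=a)" for x z a
      using False by (auto simp: glue_def)
    have 3: "(\<Sum>a<q. \<Sum>z\<in>configs ({..<n} - R) q. g z a) = (\<Sum>z\<in>configs ({..<n} - R) q. \<Sum>a<q. g z a)"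
      for g :: "_ \<Rightarrow> _ \<Rightarrow> complex"
      by (rule sum.swap)
    show ?thesis
      unfolding 1 using False by (simp add: Let_def sum_configs_insert Suc.IH 2 3)
  qed
qed

text \<open>The two Gram matrices of u, by rows and by columns, have equal Hilbert-Schmidt norm:
  both squares expand to the same fourfold sum, regrouped.\<close>

lemma sum_gram_norms_eq:
  fixes u :: "'a \<Rightarrow> 'b \<Rightarrow> complex"
  shows "(\<Sum>x\<in>X. \<Sum>y\<in>X. (cmod (\<Sum>z\<in>Z. u x z * cnj (u y z)))\<^sup>2)
    = (\<Sum>z\<in>Z. \<Sum>w\<in>Z. (cmod (\<Sum>x\<in>X. u x z * cnj (u x w)))\<^sup>2)" (is "?L = ?R")
proof -
  have "complex_of_real ?L = (\<Sum>x\<in>X. \<Sum>y\<in>X. \<Sum>z\<in>Z. \<Sum>w\<in>Z. u x z * cnj (u y z) * (cnj (u x w) * u y w))"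
    unfolding of_real_sum complex_norm_square by (simp add: sum_product)
  also have "\<dots> = (\<Sum>z\<in>Z. \<Sum>w\<in>Z. \<Sum>x\<in>X. \<Sum>y\<in>X. u x z * cnj (u x w) * (cnj (u y z) * u y w))"
    by (subst sum_swap_pairs) (simp add: mult_ac)
  also have "\<dots> = complex_of_real ?R"
    unfolding of_real_sum complex_norm_square by (simp add: sum_product)
  finally show ?thesis by (simp only: of_real_eq_iff)
qed

text \<open>Reduced states are Hermitian, so this sum of squared entries is the trace of the squared
  reduced state.\<close>

definition purity :: "nat \<Rightarrow> nat \<Rightarrow> ((nat \<Rightarrow> nat) \<Rightarrow> complex) \<Rightarrow> nat set \<Rightarrow> real" where
  "purity n q psi S = (\<Sum>x\<in>configs S q. \<Sum>y\<in>configs S q. (cmod (reduced_state n q S psi x y))\<^sup>2)"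

text \<open>The reduced states on the two sides of the cut are Gram matrices of the same coefficient
  matrix.\<close>

lemma purity_complement:
  assumes "S \<subseteq> {..<n}"
  shows "purity n q psi ({..<n} - S) = purity n q psi S"
proof -
  have c: "{..<n} - ({..<n} - S) = S" using assms by auto
  \<comment> \<open>At sites from n on, the two sides read different functions, but both are
    \<open>undefined\<close> there by extensionality.\<close>
  have g: "glue ({..<n} - S) z x = glue S x z"
    if "x \<in> configs S q" "z \<in> configs ({..<n} - S) q" for x z
    using that assms by (fastforce simp: glue_def configs_def PiE_def extensional_def fun_eq_iff)
  have "purity n q psi ({..<n} - S) = 
    (\<Sum>z\<in>configs ({..<n} - S) q. \<Sum>w\<in>configs ({..<n} - S) q.
      (cmod (\<Sum>x\<in>configs S q. psi (glue S x z) * cnj (psi (glue S x w))))\<^sup>2)"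
    unfolding purity_def reduced_state_def c by (simp add: g cong: sum.cong)
  also have "\<dots> = purity n q psi S"
    unfolding purity_def reduced_state_def by (rule sum_gram_norms_eq[symmetric])
  finally show ?thesis .
qed

text \<open>The weight A(S): the Shor-Laflamme weight of the projector onto psi, restricted to
  operators with support exactly S.\<close>

definition support_weight :: "nat \<Rightarrow> nat \<Rightarrow> ((nat \<Rightarrow> nat) \<Rightarrow> complex) \<Rightarrow> nat set \<Rightarrow> real" where
  "support_weight n q psi S = site_form q {} S n (\<lambda>x y. psi x * cnj (psi y))"

lemma support_weight_nonneg: "support_weight n q psi S \<ge> 0"
  by (simp add: support_weight_def site_form_nonneg)

lemma purity_eq_sum_weights:
  assumes "S \<subseteq> {..<n}"
  shows "real q ^ card S * purity n q psi S = (\<Sum>T\<in>Pow S. support_weight n q psi T)"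
proof -
  have "S \<inter> {..<n} = S" using assms by auto
  then show ?thesis
    using site_form_eq_purity[of q S n "\<lambda>x y. psi x * cnj (psi y)"]
      site_form_eq_sum_traceless[of q S n "\<lambda>x y. psi x * cnj (psi y)"]
    by (simp add: support_weight_def purity_def reduced_state_def)
qed

text \<open>Passing from S to T only adds nonnegative weights. The scaling matters: purity itself is
  not monotone.\<close>

lemma scaled_purity_mono:
  assumes "S \<subseteq> T" "T \<subseteq> {..<n}"
  shows "real q ^ card S * purity n q psi S \<le> real q ^ card T * purity n q psi T"
proof -
  have "finite T" using assms finite_subset by blast
  have "S \<subseteq> {..<n}" using assms by blast
  show ?thesis
    unfolding purity_eq_sum_weights[OF \<open>S \<subseteq> {..<n}\<close>] purity_eq_sum_weights[OF assms(2)]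
    using assms \<open>finite T\<close> by (intro sum_mono2) (auto simp: support_weight_nonneg)
qed

lemma purity_empty:
  assumes "pure_state n q psi"
  shows "purity n q psi {} = 1"
proof -
  have "reduced_state n q {} psi x y = 1" for x y
  proof -
    have "reduced_state n q {} psi x y
        = complex_of_real (\<Sum>z\<in>configs {..<n} q. (cmod (psi z))\<^sup>2)"
      unfolding reduced_state_def of_real_sum complex_norm_square by (simp add: glue_def)
    then show ?thesis using assms by (simp only: pure_state_def of_real_1)
  qed
  then show ?thesis by (simp add: purity_def configs_def)
qed

section \<open>k-uniformity and the Plotkin bound\<close>

lemma k_uniform_purity:
  assumes "k_uniform n q k psi" "S \<subseteq> {..<n}" "card S = k" "q > 0"
  shows "real q ^ k * purity n q psi S = 1"
proof -
  have fin: "finite S" using assms finite_subset by blast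
  have "purity n q psi S = (\<Sum>x\<in>configs S q. \<Sum>y\<in>configs S q. if x = y then (1 / real q ^ k)\<^sup>2 else 0)"
    unfolding purity_def
    using assms by (intro sum.cong refl) (auto simp: k_uniform_def norm_divide norm_power)
  also have "\<dots> = real (card (configs S q)) * (1 / real q ^ k)\<^sup>2"
    using finite_configs[OF fin] by simp
  also have "card (configs S q) = q ^ k"
    using fin assms by (simp add: configs_def card_PiE)
  finally show ?thesis using \<open>q > 0\<close> by (simp add: power2_eq_square)
qed

text \<open>Enlarge T to a set S of size k. The weights of the subsets of S sum to 1, and the empty
  set alone already has weight 1.\<close>

lemma k_uniform_weight_eq_0:
  assumes "k_uniform n q k psi" "T \<subseteq> {..<n}" "T \<noteq> {}" "card T \<le> k" "q > 0"
  shows "support_weight n q psi T = 0"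
proof -
  have "k \<le> card {..<n}" using assms by (simp add: k_uniform_def)
  then obtain S where S: "T \<subseteq> S" "S \<subseteq> {..<n}" "card S = k"
    using exists_subset_between[of T k "{..<n}"] assms by auto
  have "finite S" using S finite_subset by blast
  have "(\<Sum>U\<in>{{}, T}. support_weight n q psi U) \<le> (\<Sum>U\<in>Pow S. support_weight n q psi U)"
    using S \<open>finite S\<close> by (intro sum_mono2) (auto simp: support_weight_nonneg)
  also have "\<dots> = 1"
    using purity_eq_sum_weights[OF S(2)] k_uniform_purity[OF assms(1) S(2,3) assms(5)] S(3) by metis
  finally have "support_weight n q psi {} + support_weight n q psi T \<le> 1"
    using assms(3) by simp
  moreover have "support_weight n q psi {} = 1"
    using purity_eq_sum_weights[of "{}" n q psi] purity_empty assms(1) by (simp add: k_uniform_def)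
  ultimately show ?thesis using support_weight_nonneg[of n q psi T] by linarith
qed

text \<open>The parameter m is slack: taking r at least (n + m)/2 forces
  \<open>B R \<ge> q ^ m\<close>, so the 1 in \<open>B R - 1\<close> costs no more than the factor
  \<open>1 - 1 / q ^ m\<close>.\<close>

theorem k_uniform_plotkin_bound:
  assumes uni: "k_uniform n q k psi" and q: "q > 0"
    and r: "r \<le> n" "n + m \<le> 2 * r"
  shows "real (k + 1) * (1 - 1 / real q ^ m) \<le> real r * (1 - 1 / (real q)\<^sup>2)"
proof -
  define R where "R = {..<r}"
  define B where "B S = real q ^ card S * purity n q psi S" for S
  let ?A = "support_weight n q psi"
  have R: "R \<subseteq> {..<n}" "finite R" "card R = r" using r by (auto simp: R_def)
  have B_sum: "B S = (\<Sum>T\<in>Pow S. ?A T)" if "S \<subseteq> R" for S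
    unfolding B_def using that R by (intro purity_eq_sum_weights) auto
  have B0: "B {} = 1" using uni purity_empty by (simp add: B_def k_uniform_def)
  have A0: "?A {} = 1" using B_sum[of "{}"] B0 by simp
  have mono: "B S \<le> B T" if "S \<subseteq> T" "T \<subseteq> {..<n}" for S T
    unfolding B_def using that by (rule scaled_purity_mono)
  \<comment> \<open>Multiplying by \<open>q ^ n\<close> avoids the possibly negative exponent 2|S| -
    n.\<close>
  have dual: "real q ^ n * B S = real q ^ (2 * card S) * B ({..<n} - S)" if "S \<subseteq> {..<n}" for S
  proof -
    have "finite S" using that finite_subset by blast
    have "card S \<le> n" using card_mono[OF _ that] by simp
    then have "real q ^ (2 * card S) * real q ^ card ({..<n} - S) = real q ^ n * real q ^ card S"
      using that \<open>finite S\<close> by (simp add: card_Diff_subset add.commute flip: power_add)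
    then show ?thesis by (simp add: B_def purity_complement[OF that])
  qed
  have B_large: "B R \<ge> real q ^ m"
  proof -
    have "real q ^ n * real q ^ m \<le> real q ^ (2 * r)"
      using r q by (simp add: power_increasing flip: power_add)
    also have "\<dots> \<le> real q ^ (2 * r) * B ({..<n} - R)"
      using mono[of "{}" "{..<n} - R"] B0 by (simp add: mult_le_cancel_left1)
    also have "\<dots> = real q ^ n * B R" using dual[OF R(1)] R(3) by simp
    finally show ?thesis using q by simp
  qed
  \<comment> \<open>Removing i enlarges the complement, so monotonicity is used there; duality turns
    the change of |R| by one into the factor \<open>q\<^sup>2\<close>.\<close>
  have drop: "B R \<le> (real q)\<^sup>2 * B (R - {i})" if i: "i \<in> R" for i
  proof -
    have "card (R - {i}) = r - 1" "r \<ge> 1"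
      using i R by (auto simp: Suc_le_eq card_gt_0_iff)
    then have c: "2 * r = 2 * card (R - {i}) + 2" by simp
    have "real q ^ n * B R = real q ^ (2 * r) * B ({..<n} - R)" using dual[OF R(1)] R(3) by simp
    also have "\<dots> \<le> real q ^ (2 * r) * B ({..<n} - (R - {i}))"
      by (intro mult_left_mono mono) auto
    also have "\<dots> = (real q)\<^sup>2 * (real q ^ (2 * card (R - {i})) * B ({..<n} - (R - {i})))"
      unfolding c power_add by simp
    also have "\<dots> = (real q)\<^sup>2 * (real q ^ n * B (R - {i}))"
      using dual[of "R - {i}"] R(1) by (simp add: subset_iff)
    finally show ?thesis using q by simp
  qed
  have "real (k + 1) * (B R - 1) = (\<Sum>T\<in>Pow R - {{}}. real (k + 1) * ?A T)"
    using R(2) by (simp add: B_sum sum_diff1 A0 flip: sum_distrib_left)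
  also have "\<dots> \<le> (\<Sum>T\<in>Pow R - {{}}. real (card T) * ?A T)"
  proof (intro sum_mono)
    fix T assume T: "T \<in> Pow R - {{}}"
    show "real (k + 1) * ?A T \<le> real (card T) * ?A T"
    proof (cases "card T \<le> k")
      case True
      then have "?A T = 0" using T R(1) by (intro k_uniform_weight_eq_0[OF uni _ _ _ q]) auto
      then show ?thesis by simp
    qed (simp add: mult_right_mono support_weight_nonneg)
  qed
  also have "\<dots> = (\<Sum>T\<in>Pow R. real (card T) * ?A T)"
    using R(2) by (intro sum.mono_neutral_left) auto
  \<comment> \<open>Double counting of the pairs of a set T and an element i of it.\<close>
  also have "\<dots> = (\<Sum>T\<in>Pow R. \<Sum>i\<in>R. if i \<in> T then ?A T else 0)"
  proof (intro sum.cong refl)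
    fix T assume "T \<in> Pow R"
    then have "R \<inter> T = T" by auto
    then show "real (card T) * ?A T = (\<Sum>i\<in>R. if i \<in> T then ?A T else 0)"
      using R(2) by (simp flip: sum.inter_restrict)
  qed
  also have "\<dots> = (\<Sum>i\<in>R. \<Sum>T\<in>Pow R. if i \<in> T then ?A T else 0)" by (rule sum.swap)
  also have "\<dots> = (\<Sum>i\<in>R. B R - B (R - {i}))"
  proof (intro sum.cong refl)
    fix i assume "i \<in> R"
    have "(\<Sum>T\<in>Pow R. if i \<in> T then ?A T else 0) = (\<Sum>T\<in>Pow R. ?A T) - (\<Sum>T\<in>Pow R. if i \<in> T then 0 else ?A T)"
      by (subst sum_subtractf[symmetric]) (auto intro!: sum.cong)
    also have "(\<Sum>T\<in>Pow R. if i \<in> T then 0 else ?A T) = (\<Sum>T\<in>Pow (R - {i}). ?A T)"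
      using R(2) by (intro sum.mono_neutral_cong_right) auto
    finally show "(\<Sum>T\<in>Pow R. if i \<in> T then ?A T else 0) = B R - B (R - {i})"
      by (simp add: B_sum)
  qed
  also have "\<dots> \<le> (\<Sum>i\<in>R. B R * (1 - 1 / (real q)\<^sup>2))"
    using drop q by (intro sum_mono) (simp add: field_simps)
  also have "\<dots> = B R * (real r * (1 - 1 / (real q)\<^sup>2))" using R(3) by simp
  finally have main: "real (k + 1) * (B R - 1) \<le> B R * (real r * (1 - 1 / (real q)\<^sup>2))" .
  have Bpos: "B R > 0" using B_large q by (meson less_le_trans of_nat_0_less_iff zero_less_power)
  have "real (k + 1) * (1 - 1 / real q ^ m) \<le> real (k + 1) * (1 - 1 / B R)"
    using B_large q Bpos by (intro mult_left_mono) (auto simp: frac_le)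
  also have "\<dots> \<le> real r * (1 - 1 / (real q)\<^sup>2)"
    using main Bpos by (simp add: field_simps)
  finally show ?thesis .
qed

section \<open>From the Plotkin bound to large n\<close>

theorem theorem6:
  fixes q :: nat and \<theta> :: real
  assumes "q \<ge> 2" and "\<theta> \<le> 1/2"
    and "(1/2) * ln (1 - 2*\<theta>) + (1 - \<theta>) * ln ((1 - \<theta>) / (1 - 2*\<theta>))
          + \<theta> * ln 2 - (1 - 2*\<theta>) * ln (real q) > 0"
  shows "\<exists>N. \<forall>n\<ge>N. \<forall>k psi. k_uniform n q k psi \<longrightarrow> real k \<le> \<theta> * real n"
proof -
  define c where "c = (1 - 1 / (real q)\<^sup>2) / 2"
  have c: "c < \<theta>" unfolding c_def using assms by (rule hypothesis_imp_plotkin_ratio)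
  have q: "real q \<ge> 2" using assms(1) by simp
  have c0: "c \<ge> 0" using q by (simp add: c_def)
  have "(\<lambda>m. \<theta> * (1 - (1 / real q) ^ m)) \<longlonglongrightarrow> \<theta> * (1 - 0)"
    using q by (intro tendsto_intros LIMSEQ_realpow_zero) auto
  then have "eventually (\<lambda>m. \<theta> * (1 - (1 / real q) ^ m) > c) sequentially"
    using c by (intro order_tendstoD(1)) auto
  \<comment> \<open>This m stays fixed while n grows; the strict gap between c and theta survives
    the loss from \<open>1 / q ^ m\<close>.\<close>
  then obtain m where "\<theta> * (1 - (1 / real q) ^ m) > c"
    unfolding eventually_sequentially by blast
  then have m: "\<theta> * (1 - 1 / real q ^ m) - c > 0" by (simp add: power_one_over)
  define e where "e = \<theta> * (1 - 1 / real q ^ m) - c"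
  \<comment> \<open>From \<open>N0\<close> on, the gain \<open>n * e\<close> exceeds the cost
    \<open>(m + 1) * c\<close> of the slack and of rounding r up.\<close>
  obtain N0 :: nat where N0: "real N0 > (real m + 1) * c / e" using reals_Archimedean2 by blast
  show ?thesis
  proof (intro exI[of _ "max N0 (m + 1)"] allI impI)
    fix n k psi
    assume n: "max N0 (m + 1) \<le> n" and uni: "k_uniform n q k psi"
    show "real k \<le> \<theta> * real n"
    proof (rule ccontr)
      assume k: "\<not> real k \<le> \<theta> * real n"
      \<comment> \<open>This is (n + m)/2 rounded up; \<open>n \<ge> m + 1\<close> ensures
        \<open>r \<le> n\<close>.\<close>
      define r where "r = (n + m + 1) div 2"
      have r: "r \<le> n" "n + m \<le> 2 * r" "2 * r \<le> n + m + 1" using n by (auto simp: r_def)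
      have "\<theta> * real n * (1 - 1 / real q ^ m) \<le> real (k + 1) * (1 - 1 / real q ^ m)"
        using k q by (intro mult_right_mono) auto
      also have "\<dots> \<le> real r * (1 - 1 / (real q)\<^sup>2)"
        by (rule k_uniform_plotkin_bound[OF uni _ r(1,2)]) (use assms(1) in simp)
      also have "\<dots> = real (2 * r) * c" by (simp add: c_def)
      also have "\<dots> \<le> real (n + m + 1) * c" using r(3) c0 by (intro mult_right_mono) linarith+
      finally have "real n * e \<le> (real m + 1) * c" by (simp add: e_def algebra_simps)
      moreover have "real N0 * e > (real m + 1) * c" using N0 m by (simp add: e_def field_simps)
      moreover have "real N0 * e \<le> real n * e" using n m by (intro mult_right_mono) (auto simp: e_def)
      ultimately show False by linarith
    qed
  qed
qed

end
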